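(* Let $(G,\upsilon,\varepsilon)$ be a weighted multigraph and let $v$ be a nonisolated vertex with no loops. Let $\eta(v)\in\mathbb R_{>0}$. Then $$P_{(G,\upsilon,\varepsilon)}(t)=\frac{\upsilon(v)}{\upsilon(v)+\eta(v)}P_{(G,\upsilon+\eta,\varepsilon)}(t)-\frac{\eta(v)}{\upsilon(v)+\eta(v)}\,d_{(G,\varepsilon)}(v)\,P_{(G/v,\upsilon,\varepsilon/v)}(t).$$
   Context: A graph is a finite multigraph with vertex set $V$ and edge set $E$ (loops and multiple edges allowed). A weighted multigraph $(G,\upsilon,\varepsilon)$ is a graph $G$ with vertex weights $\upsilon:V\to\mathbb R_{>0}$ and edge weights $\varepsilon:E\to\mathbb R_{>0}$. For $u,w\in V$, $\varepsilon(u,w)$ is the total edge weight between $u$ and $w$, with loops counted twice, and the degree is $d_{(G,\varepsilon)}(u)=\sum_{w\in V}\varepsilon(u,w)$; a vertex is isolated if its degree is zero. The combinatorial Laplacian is the $V\times V$ matrix $L_{(G,\varepsilon)}=D_{(G,\varepsilon)}-A_{(G,\varepsilon)}$, where $A_{(G,\varepsilon)}=(\varepsilon(u,w))_{u,w}$ and $D_{(G,\varepsilon)}$ is the diagonal matrix of degrees. Let $W_\upsilon$ be the diagonal matrix with entries given by $\upsilon$, and define $$P_{(G,\upsilon,\varepsilon)}(t)=\det(tW_\upsilon-L_{(G,\varepsilon)}).$$ The vertex weight function $\upsilon+\eta$ equals $\upsilon(v)+\eta(v)$ at $v$ and agrees with $\upsilon$ at every other vertex. The weighted graph $(G/v,\upsilon,\varepsilon/v)$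 (star-mesh transform at $v$) is obtained from $(G,\upsilon,\varepsilon)$ by deleting $v$ and all incident edges, and adding, for each unordered pair of edges $u_1v$ and $u_2v$ with $u_1\neq u_2$, a new edge $u_1u_2$ of weight $$(\varepsilon/v)(u_1u_2)=\frac{\varepsilon(u_1v)\,\varepsilon(u_2v)}{d_{(G,\varepsilon)}(v)};$$ here $\varepsilon(u_iv)$ is the weight of the individual edge. The remaining vertices and edges keep their weights. *)

theory Defs
  imports
    "HOL-Library.Uprod"
    "HOL-Combinatorics.Permutations"
    "Jordan_Normal_Form.Determinant"
begin

text \<open>
  \<open>Upair u u\<close> encodes a loop at \<open>u\<close>. Since edges are labelled, parallel edges are allowed.
\<close>

record ('v, 'e) multigraph =
  verts :: "'v set"
  edges :: "'e set"
  ends :: "'e \<Rightarrow> 'v uprod"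

definition is_multigraph :: "('v, 'e) multigraph \<Rightarrow> bool" where
  "is_multigraph G \<longleftrightarrow> finite (verts G) \<and> finite (edges G) \<and>
     (\<forall>e\<in>edges G. set_uprod (ends G e) \<subseteq> verts G)"

definition weighted_multigraph ::
  "('v, 'e) multigraph \<Rightarrow> ('v \<Rightarrow> real) \<Rightarrow> ('e \<Rightarrow> real) \<Rightarrow> bool" where
  "weighted_multigraph G \<upsilon> \<epsilon> \<longleftrightarrow> is_multigraph G \<and>
     (\<forall>u\<in>verts G. \<upsilon> u > 0) \<and> (\<forall>e\<in>edges G. \<epsilon> e > 0)"

definition edges_between :: "('v, 'e) multigraph \<Rightarrow> 'v \<Rightarrow> 'v \<Rightarrow> 'e set" where
  "edges_between G u w = {e \<in> edges G. ends G e = Upair u w}"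

definition total_weight :: "('v, 'e) multigraph \<Rightarrow> ('e \<Rightarrow> real) \<Rightarrow> 'v \<Rightarrow> 'v \<Rightarrow> real" where
  "total_weight G \<epsilon> u w = (if u = w then 2 else 1) * (\<Sum>e\<in>edges_between G u w. \<epsilon> e)"

definition wdegree :: "('v, 'e) multigraph \<Rightarrow> ('e \<Rightarrow> real) \<Rightarrow> 'v \<Rightarrow> real" where
  "wdegree G \<epsilon> u = (\<Sum>w\<in>verts G. total_weight G \<epsilon> u w)"

definition isolated :: "('v, 'e) multigraph \<Rightarrow> ('e \<Rightarrow> real) \<Rightarrow> 'v \<Rightarrow> bool" where
  "isolated G \<epsilon> u \<longleftrightarrow> wdegree G \<epsilon> u = 0"

definition loopless_at :: "('v, 'e) multigraph \<Rightarrow> 'v \<Rightarrow> bool" where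
  "loopless_at G v \<longleftrightarrow> edges_between G v v = {}"


text \<open>
  A \<open>V \<times> V\<close> matrix is a function of two arguments, of which only the values on \<open>V\<close> matter.
  Its determinant is given by the Leibniz formula over the permutations of \<open>V\<close>, so that no
  ordering of \<open>V\<close> has to be chosen; \<open>det_on_eq_det\<close> below relates it to the determinant of the
  matrix obtained from an arbitrary enumeration of \<open>V\<close>.
\<close>

definition det_on :: "'v set \<Rightarrow> ('v \<Rightarrow> 'v \<Rightarrow> 'a::comm_ring_1) \<Rightarrow> 'a" where
  "det_on V M = (\<Sum>p | p permutes V. of_int (sign p) * (\<Prod>u\<in>V. M u (p u)))"

definition diagonal :: "('v \<Rightarrow> real) \<Rightarrow> 'v \<Rightarrow> 'v \<Rightarrow> real" where
  "diagonal f u w = (if u = w then f u else 0)"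

definition laplacian :: "('v, 'e) multigraph \<Rightarrow> ('e \<Rightarrow> real) \<Rightarrow> 'v \<Rightarrow> 'v \<Rightarrow> real" where
  "laplacian G \<epsilon> u w = diagonal (wdegree G \<epsilon>) u w - total_weight G \<epsilon> u w"

definition lap_P :: "('v, 'e) multigraph \<Rightarrow> ('v \<Rightarrow> real) \<Rightarrow> ('e \<Rightarrow> real) \<Rightarrow> real \<Rightarrow> real" where
  "lap_P G \<upsilon> \<epsilon> t = det_on (verts G) (\<lambda>u w. t * diagonal \<upsilon> u w - laplacian G \<epsilon> u w)"


definition other_end :: "('v, 'e) multigraph \<Rightarrow> 'v \<Rightarrow> 'e \<Rightarrow> 'v" where
  "other_end G v e = (THE u. ends G e = Upair u v)"

text \<open>
  In the star-mesh transform, the edges \<open>Inl e\<close> are the remaining edges of \<open>G\<close>. The edge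
  \<open>Inr (Upair e\<^sub>1 e\<^sub>2)\<close> is the new edge that comes from the edges \<open>e\<^sub>1 = u\<^sub>1v\<close> and
  \<open>e\<^sub>2 = u\<^sub>2v\<close>, where \<open>u\<^sub>1 \<noteq> u\<^sub>2\<close>.
\<close>

definition star_pairs :: "('v, 'e) multigraph \<Rightarrow> 'v \<Rightarrow> 'e uprod set" where
  "star_pairs G v = {Upair e\<^sub>1 e\<^sub>2 | e\<^sub>1 e\<^sub>2 u\<^sub>1 u\<^sub>2.
     e\<^sub>1 \<in> edges_between G u\<^sub>1 v \<and> e\<^sub>2 \<in> edges_between G u\<^sub>2 v \<and> u\<^sub>1 \<noteq> u\<^sub>2}"

definition star_mesh :: "('v, 'e) multigraph \<Rightarrow> 'v \<Rightarrow> ('v, 'e + 'e uprod) multigraph" where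
  "star_mesh G v =
     \<lparr>verts = verts G - {v},
      edges = Inl ` {e \<in> edges G. v \<notin> set_uprod (ends G e)} \<union> Inr ` star_pairs G v,
      ends = (\<lambda>x. case x of Inl e \<Rightarrow> ends G e | Inr p \<Rightarrow> map_uprod (other_end G v) p)\<rparr>"

text \<open>
  The two members of an element of \<open>star_pairs G v\<close> are distinct edges, so the product below is
  \<open>\<epsilon> e\<^sub>1 * \<epsilon> e\<^sub>2\<close>.
\<close>

definition star_mesh_weight ::
  "('v, 'e) multigraph \<Rightarrow> ('e \<Rightarrow> real) \<Rightarrow> 'v \<Rightarrow> 'e + 'e uprod \<Rightarrow> real" where
  "star_mesh_weight G \<epsilon> v x =
     (case x of Inl e \<Rightarrow> \<epsilon> e | Inr p \<Rightarrow> (\<Prod>e\<in>set_uprod p. \<epsilon> e) / wdegree G \<epsilon> v)"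


lemma other_end_eq: "ends G e = Upair u v \<Longrightarrow> other_end G v e = u"
  unfolding other_end_def by (rule the_equality) auto

lemma star_mesh_weight_new_edge:
  assumes "e\<^sub>1 \<in> edges_between G u\<^sub>1 v" "e\<^sub>2 \<in> edges_between G u\<^sub>2 v" "u\<^sub>1 \<noteq> u\<^sub>2"
  shows "star_mesh_weight G \<epsilon> v (Inr (Upair e\<^sub>1 e\<^sub>2)) = \<epsilon> e\<^sub>1 * \<epsilon> e\<^sub>2 / wdegree G \<epsilon> v"
    and "ends (star_mesh G v) (Inr (Upair e\<^sub>1 e\<^sub>2)) = Upair u\<^sub>1 u\<^sub>2"
proof -
  have e: "ends G e\<^sub>1 = Upair u\<^sub>1 v" "ends G e\<^sub>2 = Upair u\<^sub>2 v"
    using assms by (auto simp: edges_between_def)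
  have "e\<^sub>1 \<noteq> e\<^sub>2" using e assms(3) by auto
  then show "star_mesh_weight G \<epsilon> v (Inr (Upair e\<^sub>1 e\<^sub>2)) = \<epsilon> e\<^sub>1 * \<epsilon> e\<^sub>2 / wdegree G \<epsilon> v"
    by (simp add: star_mesh_weight_def)
  show "ends (star_mesh G v) (Inr (Upair e\<^sub>1 e\<^sub>2)) = Upair u\<^sub>1 u\<^sub>2"
    using e by (simp add: star_mesh_def other_end_eq)
qed

lemma wdegree_nonneg:
  assumes "weighted_multigraph G \<upsilon> \<epsilon>"
  shows "wdegree G \<epsilon> u \<ge> 0"
  unfolding wdegree_def total_weight_def
  by (intro sum_nonneg mult_nonneg_nonneg)
    (use assms in \<open>auto simp: weighted_multigraph_def edges_between_def less_imp_le\<close>)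

lemma weighted_multigraph_star_mesh:
  assumes G: "weighted_multigraph G \<upsilon> \<epsilon>"
    and v: "\<not> isolated G \<epsilon> v" "loopless_at G v"
  shows "weighted_multigraph (star_mesh G v) \<upsilon> (star_mesh_weight G \<epsilon> v)"
proof -
  have fin: "finite (edges G)" and sub: "\<And>e. e \<in> edges G \<Longrightarrow> set_uprod (ends G e) \<subseteq> verts G"
    and pos: "\<And>e. e \<in> edges G \<Longrightarrow> \<epsilon> e > 0"
    using G by (auto simp: weighted_multigraph_def is_multigraph_def)
  have d: "wdegree G \<epsilon> v > 0"
    using wdegree_nonneg[OF G, of v] v(1) by (simp add: isolated_def)
  have "star_pairs G v \<subseteq> (\<lambda>(a, b). Upair a b) ` (edges G \<times> edges G)"
    by (auto simp: star_pairs_def edges_between_def)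
  then have "finite (star_pairs G v)"
    using fin by (meson finite_SigmaI finite_imageI finite_subset)
  moreover have "set_uprod (ends (star_mesh G v) (Inr p)) \<subseteq> verts G - {v}
      \<and> star_mesh_weight G \<epsilon> v (Inr p) > 0" if p_in: "p \<in> star_pairs G v" for p
  proof -
    obtain e\<^sub>1 e\<^sub>2 u\<^sub>1 u\<^sub>2 where p: "p = Upair e\<^sub>1 e\<^sub>2" and e: "e\<^sub>1 \<in> edges_between G u\<^sub>1 v"
      "e\<^sub>2 \<in> edges_between G u\<^sub>2 v" "u\<^sub>1 \<noteq> u\<^sub>2"
      using p_in unfolding star_pairs_def by blast
    have "u\<^sub>1 \<noteq> v" "u\<^sub>2 \<noteq> v"
      using e v(2) by (auto simp: loopless_at_def)
    moreover have "u\<^sub>1 \<in> verts G" "u\<^sub>2 \<in> verts G"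
      using e sub[of e\<^sub>1] sub[of e\<^sub>2] by (auto simp: edges_between_def)
    ultimately show ?thesis
      unfolding p star_mesh_weight_new_edge[OF e]
      using e pos d by (auto simp: edges_between_def)
  qed
  ultimately show ?thesis
    using G unfolding weighted_multigraph_def is_multigraph_def
    by (auto simp: star_mesh_def star_mesh_weight_def; blast)
qed

lemma det_on_eq_det:
  assumes f: "bij_betw f {0..<n} V"
  shows "det_on V M = det (mat n n (\<lambda>(i, j). M (f i) (f j)))"
proof -
  have V: "f ` {0..<n} = V" and inj: "inj_on f {0..<n}"
    using f by (auto simp: bij_betw_def)
  have "det (mat n n (\<lambda>(i, j). M (f i) (f j))) =
      (\<Sum>p | p permutes {0..<n}. of_int (sign p) * (\<Prod>i = 0..<n. M (f i) (f (p i))))"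
    unfolding Determinant.det_def
    by (auto intro!: sum.cong prod.cong arg_cong2[where f="(*)"]
        simp: permutes_in_image)
  also have "\<dots> = (\<Sum>p | p permutes {0..<n}. of_int (sign (map_permutation {0..<n} f p)) *
      (\<Prod>u\<in>V. M u (map_permutation {0..<n} f p u)))"
  proof (rule sum.cong[OF refl])
    fix p assume "p \<in> {p. p permutes {0..<n}}"
    then have p: "p permutes {0..<n}" by simp
    have "sign (map_permutation {0..<n} f p) = sign p"
      using p inj by (simp add: sign_map_permutation)
    moreover have "(\<Prod>u\<in>V. M u (map_permutation {0..<n} f p u)) = (\<Prod>i = 0..<n. M (f i) (f (p i)))"
      unfolding V[symmetric] prod.reindex[OF inj] o_def
      by (intro prod.cong refl) (simp add: map_permutation_apply[OF inj])
    ultimately show "of_int (sign p) * (\<Prod>i = 0..<n. M (f i) (f (p i))) =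
        of_int (sign (map_permutation {0..<n} f p)) *
        (\<Prod>u\<in>V. M u (map_permutation {0..<n} f p u))" by simp
  qed
  also have "\<dots> = det_on V M"
    unfolding det_on_def
  proof (rule sum.reindex_bij_betw)
    have "map_permutation {0..<n} f =
        (\<lambda>p x. if x \<in> V then f (p (inv_into {0..<n} f x)) else x)"
      unfolding map_permutation_def restrict_id_def V o_def ..
    then show "bij_betw (map_permutation {0..<n} f) {p. p permutes {0..<n}} {p. p permutes V}"
      using bij_betw_permutations[OF f] by simp
  qed
  finally show ?thesis ..
qed

end

theory Submission
  imports Defs
begin

text \<open>
  Row \<open>v\<close> of \<open>t W\<^sub>\<upsilon> - L\<close> depends affinely on the weight of \<open>v\<close>, so the polynomial for \<open>\<upsilon> v\<close> is
  the convex combination of those for the weights \<open>\<upsilon> v + \<eta>\<close> and \<open>0\<close>, with coefficients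
  \<open>\<upsilon> v / (\<upsilon> v + \<eta>)\<close> and \<open>\<eta> / (\<upsilon> v + \<eta>)\<close>. This is linearity of the determinant in one row,
  \<open>det_on_row_linear\<close>.

  At weight \<open>0\<close> the diagonal entry at \<open>v\<close> is \<open>-d(v)\<close>, because \<open>v\<close> has no loops, and it is nonzero
  because \<open>v\<close> is not isolated. Taking it as the pivot, \<open>det_on_schur\<close> turns the determinant into
  \<open>-d(v)\<close> times that of the Schur complement, which has \<open>\<epsilon>(u,v) \<epsilon>(v,w) / d(v)\<close> added at \<open>(u,w)\<close>.
  For \<open>u \<noteq> w\<close> this is the total weight of the new edges between \<open>u\<close> and \<open>w\<close>
  (\<open>total_weight_star_mesh\<close>). For \<open>u = w\<close> it is the degree that \<open>u\<close> loses: \<open>u\<close> gives up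
  \<open>\<epsilon>(u,v)\<close> and gains the fraction \<open>(d(v) - \<epsilon>(u,v)) / d(v)\<close> of it back (\<open>wdegree_star_mesh\<close>).
  Hence the Schur complement is exactly the matrix whose determinant is the polynomial of the
  star-mesh transform (\<open>laplacian_star_mesh\<close>).
\<close>

section \<open>Determinants indexed by a finite set\<close>

lemma det_on_cong:
  assumes "\<And>u w. u \<in> V \<Longrightarrow> w \<in> V \<Longrightarrow> M u w = N u w"
  shows "det_on V M = det_on V N"
  unfolding det_on_def
  by (intro sum.cong refl arg_cong2[where f="(*)"] prod.cong) (auto simp: assms permutes_in_image)

lemma det_on_row_linear:
  assumes "finite V" "v \<in> V"
    and row: "\<And>w. w \<in> V \<Longrightarrow> M v w = a * A v w + b * B v w"
    and rest: "\<And>u w. u \<in> V - {v} \<Longrightarrow> w \<in> V \<Longrightarrow> A u w = M u w \<and> B u w = M u w"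
  shows "det_on V M = a * det_on V A + b * det_on V B"
proof -
  have "of_int (sign p) * (\<Prod>u\<in>V. M u (p u)) =
      a * (of_int (sign p) * (\<Prod>u\<in>V. A u (p u))) + b * (of_int (sign p) * (\<Prod>u\<in>V. B u (p u)))"
    if "p permutes V" for p
  proof -
    have pV: "p u \<in> V" if "u \<in> V" for u
      using \<open>p permutes V\<close> that by (simp add: permutes_in_image)
    have "(\<Prod>u\<in>V - {v}. A u (p u)) = (\<Prod>u\<in>V - {v}. M u (p u))"
      "(\<Prod>u\<in>V - {v}. B u (p u)) = (\<Prod>u\<in>V - {v}. M u (p u))"
      using pV rest by (auto intro!: prod.cong)
    then show ?thesis
      by (simp add: prod.remove[OF assms(1,2)] row[OF pV[OF assms(2)]] algebra_simps)
  qed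
  then show ?thesis
    by (simp add: det_on_def sum_distrib_left sum.distrib)
qed

text \<open>
  With \<open>v\<close> enumerated first, the matrix has the block factorisation
  \<open>(a r; c D) = (1 0; c/a 1) (a r; 0 D - c r / a)\<close> into triangular factors.
\<close>

lemma det_on_schur:
  fixes M :: "'v \<Rightarrow> 'v \<Rightarrow> 'a::field"
  assumes "finite V" "v \<in> V" and a: "M v v \<noteq> 0"
  shows "det_on V M = M v v * det_on (V - {v}) (\<lambda>u w. M u w - M u v * M v w / M v v)"
proof -
  obtain g where g: "bij_betw g {0..<card (V - {v})} (V - {v})"
    using ex_bij_betw_nat_finite[of "V - {v}"] assms(1) by auto
  define m where "m = card (V - {v})"
  have g: "bij_betw g {0..<m} (V - {v})"
    using g by (simp add: m_def)
  define f where "f = case_nat v g"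
  have "f ` insert 0 (Suc ` {0..<m}) = insert v (g ` {0..<m})"
    unfolding image_insert image_image by (simp add: f_def)
  moreover have "inj_on f (insert 0 (Suc ` {0..<m}))"
  proof -
    have "inj_on (\<lambda>i. f (Suc i)) {0..<m}" and "v \<notin> g ` {0..<m}"
      using g by (auto simp: f_def bij_betw_def)
    then show ?thesis
      by (auto simp: f_def inj_on_def simp del: image_Suc_atLeastLessThan)
  qed
  ultimately have f: "bij_betw f {0..<Suc m} V"
    unfolding atLeast0_lessThan_Suc_eq_insert_0
    using bij_betw_imp_surj_on[OF g] assms(2) by (simp add: bij_betw_def insert_absorb)
  define R where "R = mat 1 m (\<lambda>(i, j). M v (g j))"
  define C where "C = mat m 1 (\<lambda>(i, j). M (g i) v / M v v)"
  define S where "S = mat m m (\<lambda>(i, j). M (g i) (g j) - M (g i) v * M v (g j) / M v v)"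
  define p where "p = mat 1 1 (\<lambda>(i, j). M v v)"
  have dims: "R \<in> carrier_mat 1 m" "C \<in> carrier_mat m 1" "S \<in> carrier_mat m m"
    "p \<in> carrier_mat 1 1"
    by (simp_all add: R_def C_def S_def p_def)
  have "mat (Suc m) (Suc m) (\<lambda>(i, j). M (f i) (f j)) =
      four_block_mat p R (C * p) (C * R + S)"
    using a by (intro eq_matI)
      (auto simp: four_block_mat_def Let_def R_def C_def S_def p_def f_def scalar_prod_def
        split: nat.split)
  also have "\<dots> = four_block_mat (1\<^sub>m 1) (0\<^sub>m 1 m) C (1\<^sub>m m) * four_block_mat p R (0\<^sub>m m 1) S"
    using dims by (subst mult_four_block_mat[where ?nr1.0=1 and ?n1.0=1 and ?nr2.0=m
          and ?n2.0=m and ?nc1.0=1 and ?nc2.0=m]) auto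
  finally have "det_on V M =
      det (four_block_mat (1\<^sub>m 1) (0\<^sub>m 1 m) C (1\<^sub>m m) * four_block_mat p R (0\<^sub>m m 1) S)"
    by (simp only: det_on_eq_det[OF f])
  also have "\<dots> = det (four_block_mat (1\<^sub>m 1) (0\<^sub>m 1 m) C (1\<^sub>m m)) *
      det (four_block_mat p R (0\<^sub>m m 1) S)"
    using dims by (intro det_mult[where n="1 + m"] four_block_carrier_mat) auto
  also have "det (four_block_mat (1\<^sub>m 1) (0\<^sub>m 1 m) C (1\<^sub>m m)) = 1"
    using det_four_block_mat_upper_right_zero[OF one_carrier_mat refl dims(2) one_carrier_mat]
    by simp
  also have "det (four_block_mat p R (0\<^sub>m m 1) S) = det p * det S"
    by (rule det_four_block_mat_lower_left_zero[OF dims(4,1) refl dims(3)])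
  also have "det p = M v v"
    by (simp add: p_def det_single)
  also have "det S = det_on (V - {v}) (\<lambda>u w. M u w - M u v * M v w / M v v)"
    by (simp add: S_def det_on_eq_det[OF g])
  finally show ?thesis by simp
qed

section \<open>The Laplacian of the star-mesh transform\<close>

lemma total_weight_commute: "total_weight G \<epsilon> u w = total_weight G \<epsilon> w u"
proof -
  have "Upair u w = Upair w u"
    by simp
  then show ?thesis
    by (simp add: total_weight_def edges_between_def del: Upair_inject)
qed

lemma verts_star_mesh [simp]: "verts (star_mesh G v) = verts G - {v}"
  by (simp add: star_mesh_def)

text \<open>
  The new edges between \<open>u \<noteq> w\<close> are unordered pairs of edges at \<open>v\<close>. Ordering each pair so that
  the edge from \<open>u\<close> comes first indexes them by a product set, over which sums factor.
\<close>

lemma edges_between_star_mesh: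
  assumes "u \<noteq> v" "w \<noteq> v"
  shows "edges_between (star_mesh G v) u w = Inl ` edges_between G u w \<union>
    Inr ` (if u = w then {}
      else (\<lambda>(e, e'). Upair e e') ` (edges_between G u v \<times> edges_between G w v))"
proof -
  have new: "p \<in> star_pairs G v \<and> map_uprod (other_end G v) p = Upair u w \<longleftrightarrow>
      u \<noteq> w \<and> p \<in> (\<lambda>(e, e'). Upair e e') ` (edges_between G u v \<times> edges_between G w v)" for p
  proof
    assume p: "p \<in> star_pairs G v \<and> map_uprod (other_end G v) p = Upair u w"
    then obtain e1 e2 u1 u2 where e: "p = Upair e1 e2" "ends G e1 = Upair u1 v"
        "ends G e2 = Upair u2 v" "e1 \<in> edges G" "e2 \<in> edges G" "u1 \<noteq> u2"
      unfolding star_pairs_def edges_between_def by blast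
    moreover from e have "other_end G v e1 = u1" "other_end G v e2 = u2"
      by (blast intro: other_end_eq)+
    ultimately have "Upair u1 u2 = Upair u w"
      using p by (simp del: Upair_inject)
    then consider "u1 = u" "u2 = w" | "u1 = w" "u2 = u"
      by auto
    then show "u \<noteq> w \<and>
        p \<in> (\<lambda>(e, e'). Upair e e') ` (edges_between G u v \<times> edges_between G w v)"
    proof cases
      case 1
      then show ?thesis using e by (auto simp: edges_between_def)
    next
      case 2
      then have "p = (\<lambda>(e, e'). Upair e e') (e2, e1)"
        "(e2, e1) \<in> edges_between G u v \<times> edges_between G w v"
        using e by (auto simp: edges_between_def)
      then show ?thesis using e 2 by blast
    qed
  next
    assume "u \<noteq> w \<and>
      p \<in> (\<lambda>(e, e'). Upair e e') ` (edges_between G u v \<times> edges_between G w v)"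
    then obtain e1 e2 where e: "p = Upair e1 e2" "e1 \<in> edges_between G u v"
        "e2 \<in> edges_between G w v" "u \<noteq> w"
      by auto
    then show "p \<in> star_pairs G v \<and> map_uprod (other_end G v) p = Upair u w"
      by (auto simp: star_pairs_def edges_between_def other_end_eq)
  qed
  have "Inr p \<in> edges_between (star_mesh G v) u w \<longleftrightarrow>
      u \<noteq> w \<and> p \<in> (\<lambda>(e, e'). Upair e e') ` (edges_between G u v \<times> edges_between G w v)" for p
    unfolding new[symmetric] by (auto simp: edges_between_def star_mesh_def)
  moreover have "Inl e \<in> edges_between (star_mesh G v) u w \<longleftrightarrow> e \<in> edges_between G u w" for e
    using assms by (auto simp: edges_between_def star_mesh_def)
  ultimately have "x \<in> edges_between (star_mesh G v) u w \<longleftrightarrow> x \<in> Inl ` edges_between G u w \<union>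
    Inr ` (if u = w then {}
      else (\<lambda>(e, e'). Upair e e') ` (edges_between G u v \<times> edges_between G w v))" for x
    by (cases x) (auto simp del: Upair_inject)
  then show ?thesis by blast
qed

text \<open>
  For \<open>u \<noteq> w\<close>, distinct pairs of edges \<open>uv\<close>, \<open>wv\<close> give distinct new edges, so the sum of the
  products of their weights factors into the product of the two total weights.
\<close>

lemma total_weight_star_mesh:
  assumes "finite (edges G)" "u \<noteq> v" "w \<noteq> v"
  shows "total_weight (star_mesh G v) (star_mesh_weight G \<epsilon> v) u w = total_weight G \<epsilon> u w +
    (if u = w then 0 else total_weight G \<epsilon> u v * total_weight G \<epsilon> v w / wdegree G \<epsilon> v)"
proof (cases "u = w")
  case True
  then have "edges_between (star_mesh G v) u w = Inl ` edges_between G u w"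
    unfolding edges_between_star_mesh[OF assms(2,3)] by simp
  with True show ?thesis
    by (simp add: total_weight_def sum.reindex star_mesh_weight_def)
next
  case False
  let ?E = "edges_between G"
  let ?pairs = "(\<lambda>(e, e'). Upair e e') ` (?E u v \<times> ?E w v)"
  have fin: "finite (?E x y)" for x y
    using assms(1) by (simp add: edges_between_def)
  have disj: "e \<noteq> e'" if "e \<in> ?E u v" "e' \<in> ?E w v" for e e'
    using that False by (auto simp: edges_between_def)
  have inj: "inj_on (\<lambda>(e, e'). Upair e e') (?E u v \<times> ?E w v)"
    using disj by (auto simp: inj_on_def)
  have "(\<Sum>p\<in>?pairs. star_mesh_weight G \<epsilon> v (Inr p)) =
      (\<Sum>(e, e')\<in>?E u v \<times> ?E w v. \<epsilon> e * \<epsilon> e' / wdegree G \<epsilon> v)"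
    unfolding sum.reindex[OF inj]
    by (auto intro!: sum.cong simp: star_mesh_weight_def dest: disj)
  also have "\<dots> = (\<Sum>e\<in>?E u v. \<epsilon> e) * (\<Sum>e\<in>?E w v. \<epsilon> e) / wdegree G \<epsilon> v"
    by (simp add: sum_product sum.cartesian_product sum_divide_distrib split_def)
  finally have new: "(\<Sum>p\<in>?pairs. star_mesh_weight G \<epsilon> v (Inr p)) =
      total_weight G \<epsilon> u v * total_weight G \<epsilon> v w / wdegree G \<epsilon> v"
    unfolding total_weight_commute[of G \<epsilon> v w] using assms by (simp add: total_weight_def)
  have "(\<Sum>x\<in>edges_between (star_mesh G v) u w. star_mesh_weight G \<epsilon> v x) =
      (\<Sum>e\<in>?E u w. star_mesh_weight G \<epsilon> v (Inl e)) +
      (\<Sum>p\<in>?pairs. star_mesh_weight G \<epsilon> v (Inr p))"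
    using False fin unfolding edges_between_star_mesh[OF assms(2,3)]
    by (subst sum.union_disjoint) (auto simp: sum.reindex)
  with new False show ?thesis
    by (simp add: total_weight_def star_mesh_weight_def)
qed

lemma wdegree_star_mesh:
  assumes fin: "finite (edges G)" "finite (verts G)"
    and uv: "u \<in> verts G - {v}" "v \<in> verts G"
    and v: "wdegree G \<epsilon> v \<noteq> 0" "loopless_at G v"
  shows "wdegree (star_mesh G v) (star_mesh_weight G \<epsilon> v) u =
    wdegree G \<epsilon> u - total_weight G \<epsilon> u v * total_weight G \<epsilon> v u / wdegree G \<epsilon> v"
proof -
  let ?tw = "total_weight G \<epsilon>" and ?d = "wdegree G \<epsilon>" and ?V = "verts G - {v}"
  have dv: "?d v = (\<Sum>w\<in>?V. ?tw v w)"
    using v(2) unfolding wdegree_def sum.remove[OF fin(2) uv(2)]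
    by (simp add: total_weight_def loopless_at_def)
  have "wdegree (star_mesh G v) (star_mesh_weight G \<epsilon> v) u =
      (\<Sum>w\<in>?V. ?tw u w + (if u = w then 0 else ?tw u v * ?tw v w / ?d v))"
    unfolding wdegree_def[of "star_mesh G v"] using fin(1) uv
    by (intro sum.cong) (auto simp: total_weight_star_mesh)
  also have "\<dots> = (\<Sum>w\<in>?V. ?tw u w) + (\<Sum>w\<in>?V - {u}. ?tw u v * ?tw v w / ?d v)"
    using fin(2) uv(1) by (simp add: sum.distrib sum.remove[of ?V u]) (auto intro: sum.cong)
  also have "(\<Sum>w\<in>?V - {u}. ?tw u v * ?tw v w / ?d v) = ?tw u v * (?d v - ?tw v u) / ?d v"
    using fin(2) uv(1) unfolding dv sum.remove[of ?V u, OF finite_Diff[OF fin(2)] uv(1)]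
    by (simp add: sum_distrib_left sum_divide_distrib)
  also have "(\<Sum>w\<in>?V. ?tw u w) = ?d u - ?tw u v"
    unfolding wdegree_def sum.remove[OF fin(2) uv(2)] by simp
  finally show ?thesis
    using v(1) by (simp add: field_simps)
qed

text \<open>
  Since \<open>v\<close> has no loops, \<open>d(v)\<close> is the diagonal entry of the Laplacian at \<open>v\<close>, so the
  right-hand side is the Schur complement of that entry: the star-mesh transform is Gaussian
  elimination of the vertex \<open>v\<close>.
\<close>

lemma laplacian_star_mesh:
  assumes fin: "finite (edges G)" "finite (verts G)"
    and v: "v \<in> verts G" "wdegree G \<epsilon> v \<noteq> 0" "loopless_at G v"
    and uw: "u \<in> verts G - {v}" "w \<in> verts G - {v}"
  shows "laplacian (star_mesh G v) (star_mesh_weight G \<epsilon> v) u w =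
    laplacian G \<epsilon> u w - laplacian G \<epsilon> u v * laplacian G \<epsilon> v w / wdegree G \<epsilon> v"
  using uw v
  by (auto simp: laplacian_def diagonal_def total_weight_star_mesh[OF fin(1)]
      wdegree_star_mesh[OF fin])

section \<open>The recursion\<close>

theorem theorem6p8:
  fixes G :: "('v, 'e) multigraph" and \<upsilon> :: "'v \<Rightarrow> real" and \<epsilon> :: "'e \<Rightarrow> real"
    and v :: 'v and \<eta> t :: real
  assumes "weighted_multigraph G \<upsilon> \<epsilon>"
    and "v \<in> verts G"
    and "\<not> isolated G \<epsilon> v"
    and "loopless_at G v"
    and "\<eta> > 0"
  shows "lap_P G \<upsilon> \<epsilon> t =
    \<upsilon> v / (\<upsilon> v + \<eta>) * lap_P G (\<upsilon>(v := \<upsilon> v + \<eta>)) \<epsilon> t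
    - \<eta> / (\<upsilon> v + \<eta>) * wdegree G \<epsilon> v * lap_P (star_mesh G v) \<upsilon> (star_mesh_weight G \<epsilon> v) t"
proof -
  have fin: "finite (edges G)" "finite (verts G)"
    using assms(1) by (auto simp: weighted_multigraph_def is_multigraph_def)
  have "\<upsilon> v > 0"
    using assms(1,2) by (auto simp: weighted_multigraph_def)
  then have s: "\<upsilon> v + \<eta> \<noteq> 0"
    using assms(5) by simp
  have d: "wdegree G \<epsilon> v \<noteq> 0"
    using assms(3) by (simp add: isolated_def)
  define M where "M = (\<lambda>\<omega> u w. t * diagonal \<omega> u w - laplacian G \<epsilon> u w)"
  \<comment> \<open>Weight \<open>0\<close> at \<open>v\<close> removes \<open>t\<close> from the entry \<open>(v, v)\<close> and leaves \<open>- d(v)\<close> as the pivot.\<close>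
  define M0 where "M0 = M (\<upsilon>(v := 0))"
  have pivot: "M0 v v = - wdegree G \<epsilon> v"
    using assms(4)
    by (simp add: M0_def M_def diagonal_def laplacian_def total_weight_def loopless_at_def)
  define a where "a = \<upsilon> v / (\<upsilon> v + \<eta>)"
  have a: "\<upsilon> v = a * (\<upsilon> v + \<eta>)" "\<eta> / (\<upsilon> v + \<eta>) = 1 - a"
    using s by (simp_all add: a_def field_simps)
  have "M \<upsilon> v w = a * M (\<upsilon>(v := \<upsilon> v + \<eta>)) v w + (1 - a) * M0 v w" for w
  proof (cases "v = w")
    case True
    have "M \<upsilon> v w = t * (a * (\<upsilon> v + \<eta>)) - laplacian G \<epsilon> v v"
      using True a(1) by (simp add: M_def diagonal_def)
    with True show ?thesis
      by (simp add: M0_def M_def diagonal_def algebra_simps)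
  next
    case False
    then show ?thesis
      by (simp add: M0_def M_def diagonal_def algebra_simps)
  qed
  then have "det_on (verts G) (M \<upsilon>) =
      a * det_on (verts G) (M (\<upsilon>(v := \<upsilon> v + \<eta>))) + (1 - a) * det_on (verts G) M0"
    by (intro det_on_row_linear[OF fin(2) assms(2)]) (auto simp: M0_def M_def diagonal_def)
  moreover have "det_on (verts G) M0 =
      - wdegree G \<epsilon> v * lap_P (star_mesh G v) \<upsilon> (star_mesh_weight G \<epsilon> v) t"
  proof -
    have "M0 u w - M0 u v * M0 v w / M0 v v =
        t * diagonal \<upsilon> u w - laplacian (star_mesh G v) (star_mesh_weight G \<epsilon> v) u w"
      if "u \<in> verts G - {v}" "w \<in> verts G - {v}" for u w
      using that unfolding pivot laplacian_star_mesh[OF fin assms(2) d assms(4) that]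
      by (auto simp: M0_def M_def diagonal_def)
    then have "det_on (verts G - {v}) (\<lambda>u w. M0 u w - M0 u v * M0 v w / M0 v v) =
        lap_P (star_mesh G v) \<upsilon> (star_mesh_weight G \<epsilon> v) t"
      unfolding lap_P_def by (auto intro: det_on_cong)
    then show ?thesis
      using d det_on_schur[of "verts G" v M0] fin(2) assms(2) by (simp add: pivot)
  qed
  ultimately show ?thesis
    unfolding a(2) a_def[symmetric] by (simp add: lap_P_def M_def)
qed

end
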